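(* Let $r\ge 1$, let $S$ be a configuration of $n$ points in $\mathbb{R}^r$ whose affine span is $\mathbb{R}^r$, and let $m$ be a positive integer. Then $$\mathcal{C}_m(S)\subseteq \mathcal{D}_{3m-2(n-r)}(S).$$
   Context: Repeated points in $S$ are allowed and counted with multiplicity (as distinct labelled elements). The $m$-core $\mathcal{C}_m(S)$ is the set of points $x\in\mathbb{R}^r$ such that every closed halfspace containing $x$ also contains at least $m$ points of $S$. For $k\ge1$, the set $\mathcal{D}_k(S)$ of Tverberg points of order $k$ is the set of $x\in\mathbb{R}^r$ for which there exist $k$ pairwise disjoint subsets $S_1,\dots,S_k$ of $S$ with $x\in\mathrm{conv}(S_i)$ for all $i=1,\dots,k$. For $k\le 0$ the condition is void, i.e. $\mathcal{D}_k(S)=\mathbb{R}^r$. *)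

theory Defs
  imports "HOL-Analysis.Analysis"
begin

(* A configuration is a family p indexed by a finite set I of labels, so that repeated points
   count with multiplicity; subsets of the configuration are subsets of I. *)

definition closed_halfspace :: "(real ^ 'r) set \<Rightarrow> bool" where
  "closed_halfspace H \<longleftrightarrow> (\<exists>a b. a \<noteq> 0 \<and> H = {y. a \<bullet> y \<le> b})"

definition core :: "nat \<Rightarrow> 'i set \<Rightarrow> ('i \<Rightarrow> real ^ 'r) \<Rightarrow> (real ^ 'r) set" where
  "core m I p = {x. \<forall>H. closed_halfspace H \<and> x \<in> H \<longrightarrow> m \<le> card {i \<in> I. p i \<in> H}}"

(* The order k is an integer. For k \<le> 0 the index set {1..k} is empty, the condition is void,
   and every point qualifies. *)

definition tverberg_points :: "int \<Rightarrow> 'i set \<Rightarrow> ('i \<Rightarrow> real ^ 'r) \<Rightarrow> (real ^ 'r) set" where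
  "tverberg_points k I p =
    {x. \<exists>T. disjoint_family_on T {1..k} \<and>
            (\<forall>j\<in>{1..k}. T j \<subseteq> I \<and> x \<in> convex hull (p ` T j))}"

end

theory Submission
  imports Defs
begin

text \<open>
  Translate \<open>x\<close> to the origin, so that \<open>\<real>\<^sup>r\<close> is the linear span of the \<open>n\<close> vectors. The claim is that some
  \<open>\<nu>\<close> disjoint subsets capture the origin while some linear functional is nonpositive on at most
  \<open>(2 (n - r) + \<nu>) / 3\<close> of the vectors; for \<open>x\<close> in the core this number is at least \<open>m\<close>. Suppose a functional \<open>v\<close> vanishes on a subfamily of corank
  one, and its support has \<open>s\<close> elements. Up to sign, \<open>v\<close> is negative on at most \<open>s div 2\<close>
  vectors, and adding a large multiple of \<open>v\<close> to a functional that is good for the subfamily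
  proves the claim by induction, since \<open>3 (s div 2) \<le> 2 (s - 1)\<close>, unless \<open>s = 2\<close> and \<open>v\<close> takes both
  signs. If only this exception occurs, then each functional dual to an element of a basis is
  negative on exactly one further vector, so that the vectors outside the basis are
  nonpositive combinations of disjoint parts of the basis.
\<close>

section \<open>Convex combinations and dual functionals\<close>

lemma zero_in_convex_hull_image:
  fixes p :: "'i \<Rightarrow> 'a::real_vector"
  assumes "finite T" "\<And>i. i \<in> T \<Longrightarrow> 0 \<le> w i" "0 < sum w T" "(\<Sum>i\<in>T. w i *\<^sub>R p i) = 0"
  shows "0 \<in> convex hull (p ` T)"
proof -
  have "(\<Sum>i\<in>T. (w i / sum w T) *\<^sub>R p i) \<in> convex hull (p ` T)"
    using assms(1-3)
    by (intro convex_sum) (auto simp: hull_inc simp flip: sum_divide_distrib)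
  moreover have "(\<Sum>i\<in>T. (w i / sum w T) *\<^sub>R p i) = (1 / sum w T) *\<^sub>R (\<Sum>i\<in>T. w i *\<^sub>R p i)"
    by (simp add: scaleR_sum_right)
  ultimately show ?thesis
    using assms(4) by simp
qed

text \<open>The component of \<open>p b\<close> orthogonal to the span of the other vectors serves
  as \<open>v\<close>; independence makes it nonzero.\<close>

lemma exists_dual_vector:
  fixes p :: "'i \<Rightarrow> 'a::euclidean_space"
  assumes "inj_on p J" "independent (p ` J)" "b \<in> J"
  obtains v where "v \<bullet> p b > 0" "\<And>c. c \<in> J \<Longrightarrow> c \<noteq> b \<Longrightarrow> v \<bullet> p c = 0"
proof -
  let ?S = "p ` (J - {b})"
  have img: "?S = p ` J - {p b}"
    using assms(1,3) by (auto simp: inj_on_def)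
  have notin: "p b \<notin> span ?S"
    using assms(2,3) unfolding img dependent_def by blast
  obtain y z where yz: "y \<in> span ?S" "\<And>w. w \<in> span ?S \<Longrightarrow> orthogonal z w" "p b = y + z"
    using orthogonal_subspace_decomp_exists by metis
  show thesis
  proof
    show "z \<bullet> p b > 0"
      using yz notin by (auto simp: inner_right_distrib orthogonal_def)
    show "z \<bullet> p c = 0" if "c \<in> J" "c \<noteq> b" for c
      using yz(2)[of "p c"] that by (auto simp: orthogonal_def span_base)
  qed
qed

text \<open>On the finitely many labels where \<open>v\<close> is positive, a large multiple of
  \<open>v\<close> outweighs \<open>a\<close>.\<close>

lemma finite_positive_perturbation:
  fixes p :: "'i \<Rightarrow> 'a::real_inner"
  assumes "finite D"
  obtains N :: real where "\<And>i. i \<in> D \<Longrightarrow> v \<bullet> p i > 0 \<Longrightarrow> (a + N *\<^sub>R v) \<bullet> p i > 0"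
proof -
  let ?D = "{i \<in> D. v \<bullet> p i > 0}"
  have "eventually (\<lambda>N. \<forall>i\<in>?D. (a + N *\<^sub>R v) \<bullet> p i > 0) at_top"
  proof (rule eventually_ball_finite)
    show "finite ?D"
      using assms by simp
    show "\<forall>i\<in>?D. eventually (\<lambda>N. (a + N *\<^sub>R v) \<bullet> p i > 0) at_top"
    proof
      fix i assume i: "i \<in> ?D"
      have "eventually (\<lambda>N. N > - (a \<bullet> p i) / (v \<bullet> p i)) at_top"
        by (rule eventually_gt_at_top)
      then show "eventually (\<lambda>N. (a + N *\<^sub>R v) \<bullet> p i > 0) at_top"
        by eventually_elim (use i in \<open>auto simp: inner_add_left field_simps\<close>)
    qed
  qed
  then obtain N where "\<forall>i\<in>?D. (a + N *\<^sub>R v) \<bullet> p i > 0"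
    using eventually_happens'[OF trivial_limit_at_top_linorder] by blast
  then show thesis
    using that by auto
qed

section \<open>Disjoint capturing sets in the exceptional case\<close>

definition capturing_family :: "nat \<Rightarrow> 'i set \<Rightarrow> ('i \<Rightarrow> 'a::real_vector) \<Rightarrow> (nat \<Rightarrow> 'i set) \<Rightarrow> bool" where
  "capturing_family k I p T \<longleftrightarrow> disjoint_family_on T {1..k} \<and>
     (\<forall>j\<in>{1..k}. T j \<subseteq> I \<and> 0 \<in> convex hull (p ` T j))"

text \<open>Each basis element is the only positive vector of its dual functional, which has just
  one negative vector. Hence vectors outside the basis have coordinates \<le> 0, and each basis
  element occurs in exactly one of their expansions.\<close>

lemma capturing_family_if_dual_supports_are_pairs:
  fixes p :: "'i \<Rightarrow> 'a::euclidean_space"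
  assumes fin: "finite I"
    and pairs: "\<And>v. dim (p ` I) \<le> Suc (dim (p ` {i \<in> I. v \<bullet> p i = 0})) \<Longrightarrow>
      {i \<in> I. v \<bullet> p i > 0} \<noteq> {} \<Longrightarrow>
      card {i \<in> I. v \<bullet> p i > 0} = 1 \<and> card {i \<in> I. v \<bullet> p i < 0} = 1"
  shows "\<exists>a T. capturing_family (card I - dim (p ` I)) I p T \<and>
    card {i \<in> I. a \<bullet> p i \<le> 0} \<le> card I - dim (p ` I)"
proof -
  obtain B where B: "B \<subseteq> p ` I" "independent B" "p ` I \<subseteq> span B" "card B = dim (p ` I)"
    using basis_exists by metis
  obtain J where J: "J \<subseteq> I" "inj_on p J" "p ` J = B"
    using B(1) by (metis subset_image_inj)
  have finJ: "finite J"
    using J(1) fin finite_subset by blast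
  have cardJ: "card J = dim (p ` I)"
    using J B(4) card_image by metis
  have "\<exists>w. w \<bullet> p b > 0 \<and> (\<forall>c\<in>J. c \<noteq> b \<longrightarrow> w \<bullet> p c = 0)" if "b \<in> J" for b
    using exists_dual_vector[OF J(2) _ that] J(3) B(2) by metis
  then obtain v where v: "\<And>b. b \<in> J \<Longrightarrow> v b \<bullet> p b > 0"
      "\<And>b c. b \<in> J \<Longrightarrow> c \<in> J \<Longrightarrow> c \<noteq> b \<Longrightarrow> v b \<bullet> p c = 0"
    by metis
  have signs: "card {i \<in> I. v b \<bullet> p i > 0} = 1 \<and> card {i \<in> I. v b \<bullet> p i < 0} = 1" if b: "b \<in> J" for b
  proof (rule pairs)
    let ?Z = "{i \<in> I. v b \<bullet> p i = 0}"
    \<comment> \<open>The zero set of \<open>v b\<close> contains all other basis elements, so its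
      rank drops by at most one.\<close>
    have sub: "J - {b} \<subseteq> ?Z"
      using v(2) b J(1) by auto
    have "independent (p ` (J - {b}))"
      using B(2) J(3) independent_mono by (metis Diff_subset image_mono)
    then have "card (p ` (J - {b})) = dim (p ` (J - {b}))"
      by (rule dim_eq_card_independent[symmetric])
    also have "\<dots> \<le> dim (p ` ?Z)"
      using sub by (intro dim_subset image_mono)
    finally have "card (p ` (J - {b})) \<le> dim (p ` ?Z)" .
    moreover have "card (p ` (J - {b})) = card J - 1"
      using b finJ J(2) by (simp add: card_image inj_on_diff)
    ultimately show "dim (p ` I) \<le> Suc (dim (p ` ?Z))"
      using cardJ by linarith
    show "{i \<in> I. v b \<bullet> p i > 0} \<noteq> {}"
      using b v(1) J(1) by blast
  qed
  have pos_unique: "f = f'" if "b \<in> J" "f \<in> I" "f' \<in> I" "v b \<bullet> p f > 0" "v b \<bullet> p f' > 0" for b f f'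
    using card_le_Suc0_iff_eq[of "{i \<in> I. v b \<bullet> p i > 0}"] signs[OF that(1)] that fin by simp
  have neg_unique: "f = f'" if "b \<in> J" "f \<in> I" "f' \<in> I" "v b \<bullet> p f < 0" "v b \<bullet> p f' < 0" for b f f'
    using card_le_Suc0_iff_eq[of "{i \<in> I. v b \<bullet> p i < 0}"] signs[OF that(1)] that fin by simp
  \<comment> \<open>The only positive place is already taken by \<open>b\<close> itself.\<close>
  have nonpos: "v b \<bullet> p f \<le> 0" if "b \<in> J" "f \<in> I - J" for b f
    using pos_unique[OF that(1), of f b] that v(1)[OF that(1)] J(1) by force
  define C where "C f = insert f {b \<in> J. v b \<bullet> p f < 0}" for f
  have C_zero: "0 \<in> convex hull (p ` C f)" if f: "f \<in> I - J" for f
  proof -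
    have "p f \<in> span (p ` J)"
      using f B(3) J(3) by blast
    then obtain u where "p f = (\<Sum>y\<in>p ` J. u y *\<^sub>R y)"
      using finJ by (auto simp: span_finite)
    then have exp: "p f = (\<Sum>c\<in>J. u (p c) *\<^sub>R p c)"
      by (simp add: sum.reindex[OF J(2)])
    \<comment> \<open>Pairing with \<open>v b\<close> isolates one coordinate, which therefore has
      the sign of \<open>v b \<bullet> p f\<close>.\<close>
    have coeff: "v b \<bullet> p f = u (p b) * (v b \<bullet> p b)" if b: "b \<in> J" for b
    proof -
      have "v b \<bullet> p f = (\<Sum>c\<in>J. u (p c) * (v b \<bullet> p c))"
        by (simp add: exp inner_sum_right)
      also have "\<dots> = (\<Sum>c\<in>J. if c = b then u (p b) * (v b \<bullet> p b) else 0)"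
        by (intro sum.cong refl) (use v(2) b in auto)
      finally show ?thesis
        using b finJ by simp
    qed
    have u_nonpos: "u (p b) \<le> 0" if "b \<in> J" for b
      using nonpos[OF that f] coeff[OF that] v(1)[OF that] by (simp add: mult_le_0_iff)
    have u_zero: "u (p b) = 0" if "b \<in> J" "\<not> v b \<bullet> p f < 0" for b
      using nonpos[OF that(1) f] coeff[OF that(1)] v(1)[OF that(1)] that(2) by simp
    let ?N = "{b \<in> J. v b \<bullet> p f < 0}"
    have notin: "f \<notin> ?N"
      using f by auto
    have exp': "p f = (\<Sum>c\<in>?N. u (p c) *\<^sub>R p c)"
      by (subst exp, rule sum.mono_neutral_right) (use finJ u_zero in force)+
    \<comment> \<open>These are the coefficients of the relation obtained by moving the expansion of
      \<open>p f\<close> to the left. The weight 1 at \<open>f\<close> keeps their sum positive even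
      if \<open>?N\<close> is empty.\<close>
    define w where "w i = (if i = f then 1 else - u (p i))" for i
    have w_sum: "(\<Sum>i\<in>?N. w i *\<^sub>R p i) = (\<Sum>i\<in>?N. - (u (p i) *\<^sub>R p i))"
      by (intro sum.cong refl) (use notin in \<open>auto simp: w_def\<close>)
    have w_nonneg: "0 \<le> w i" if "i \<in> C f" for i
      using that u_nonpos by (auto simp: w_def C_def)
    show ?thesis
    proof (rule zero_in_convex_hull_image)
      show "finite (C f)"
        using finJ by (simp add: C_def)
      show "0 \<le> w i" if "i \<in> C f" for i
        using w_nonneg that .
      have "sum w (C f) = 1 + sum w ?N"
        using finJ notin by (simp add: C_def w_def)
      moreover have "0 \<le> sum w ?N"
        using w_nonneg by (intro sum_nonneg) (auto simp: C_def)
      ultimately show "0 < sum w (C f)"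
        by simp
      have "(\<Sum>i\<in>C f. w i *\<^sub>R p i) = p f + (\<Sum>i\<in>?N. w i *\<^sub>R p i)"
        using finJ notin by (simp add: C_def w_def)
      also have "\<dots> = 0"
        using w_sum exp' by (simp add: sum_negf)
      finally show "(\<Sum>i\<in>C f. w i *\<^sub>R p i) = 0" .
    qed
  qed
  \<comment> \<open>A common element would be a basis element whose dual functional is negative at
    both \<open>f\<close> and \<open>f'\<close>.\<close>
  have C_disj: "C f \<inter> C f' = {}" if "f \<in> I - J" "f' \<in> I - J" "f \<noteq> f'" for f f'
    using that neg_unique unfolding C_def by blast
  have card_diff: "card (I - J) = card I - dim (p ` I)"
    using J(1) finJ cardJ card_Diff_subset by metis
  obtain h where h: "bij_betw h {1..card (I - J)} (I - J)"
    using ex_bij_betw_nat_finite_1 fin by blast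
  have "capturing_family (card I - dim (p ` I)) I p (C \<circ> h)"
    unfolding capturing_family_def card_diff[symmetric]
  proof (intro conjI ballI)
    show "disjoint_family_on (C \<circ> h) {1..card (I - J)}"
      unfolding disjoint_family_on_def
    proof (intro ballI impI)
      fix i j assume ij: "i \<in> {1..card (I - J)}" "j \<in> {1..card (I - J)}" "i \<noteq> j"
      then have "h i \<noteq> h j"
        using h by (auto simp: bij_betw_def dest: inj_onD)
      then show "(C \<circ> h) i \<inter> (C \<circ> h) j = {}"
        using C_disj bij_betwE[OF h] ij by simp
    qed
  next
    fix j assume "j \<in> {1..card (I - J)}"
    then have hj: "h j \<in> I - J"
      using h bij_betwE by blast
    show "(C \<circ> h) j \<subseteq> I"
      using hj J(1) by (auto simp: C_def)
    show "0 \<in> convex hull (p ` (C \<circ> h) j)"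
      using C_zero[OF hj] by simp
  qed
  \<comment> \<open>The sum of the dual functionals is positive on the whole basis, so only labels
    outside \<open>J\<close> can count.\<close>
  moreover have "card {i \<in> I. (\<Sum>c\<in>J. v c) \<bullet> p i \<le> 0} \<le> card I - dim (p ` I)"
  proof -
    have "(\<Sum>c\<in>J. v c) \<bullet> p b > 0" if b: "b \<in> J" for b
    proof -
      have "(\<Sum>c\<in>J. v c) \<bullet> p b = (\<Sum>c\<in>J. if c = b then v b \<bullet> p b else 0)"
        unfolding inner_sum_left by (intro sum.cong refl) (use v(2) b in auto)
      then show ?thesis
        using b v(1) finJ by simp
    qed
    then have "{i \<in> I. (\<Sum>c\<in>J. v c) \<bullet> p i \<le> 0} \<subseteq> I - J"
      by force
    then show ?thesis
      using card_mono[of "I - J"] fin card_diff by simp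
  qed
  ultimately show ?thesis
    by blast
qed

text \<open>The bound is cleared of division and subtraction to suit natural numbers. The induction
  ranges over all proper subsets because it passes to the zero set of some \<open>v\<close>.\<close>

lemma capturing_family_and_functional:
  fixes p :: "'i \<Rightarrow> 'a::euclidean_space"
  assumes "finite I"
  shows "\<exists>a \<nu> T. capturing_family \<nu> I p T \<and>
    3 * card {i \<in> I. a \<bullet> p i \<le> 0} + 2 * dim (p ` I) \<le> 2 * card I + \<nu>"
  using assms
proof (induction I rule: finite_psubset_induct)
  case (psubset I)
  define Z where "Z v = {i \<in> I. v \<bullet> p i = 0}" for v
  define P where "P v = {i \<in> I. v \<bullet> p i > 0}" for v
  define N where "N v = {i \<in> I. v \<bullet> p i < 0}" for v
  have card_I: "card I = card (Z v) + card (P v) + card (N v)" for v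
  proof -
    have "I = (Z v \<union> P v) \<union> N v" "(Z v \<union> P v) \<inter> N v = {}" "Z v \<inter> P v = {}"
      by (auto simp: Z_def P_def N_def)
    moreover have "finite (Z v)" "finite (P v)" "finite (N v)"
      using psubset.hyps by (auto simp: Z_def P_def N_def)
    ultimately show ?thesis
      by (metis card_Un_disjoint finite_UnI)
  qed
  \<comment> \<open>For a support of size \<open>s = card (P v) + card (N v)\<close>, the second conjunct says \<open>3 card (N v) \<le> 2 (s - 1)\<close>.\<close>
  show ?case
  proof (cases "\<exists>v. dim (p ` I) \<le> Suc (dim (p ` Z v)) \<and> card (N v) + 2 \<le> 2 * card (P v)")
    case True
    then obtain v where v: "dim (p ` I) \<le> Suc (dim (p ` Z v))"
        "card (N v) + 2 \<le> 2 * card (P v)"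
      by blast
    have "card (Z v) < card I"
      using v(2) card_I[of v] by linarith
    then have "Z v \<subset> I"
      by (auto simp: Z_def)
    then obtain a \<nu> T where IH: "capturing_family \<nu> (Z v) p T"
        "3 * card {i \<in> Z v. a \<bullet> p i \<le> 0} + 2 * dim (p ` Z v) \<le> 2 * card (Z v) + \<nu>"
      using psubset.IH by blast
    obtain t :: real where t: "\<And>i. i \<in> I \<Longrightarrow> v \<bullet> p i > 0 \<Longrightarrow> (a + t *\<^sub>R v) \<bullet> p i > 0"
      using finite_positive_perturbation[OF psubset.hyps] by metis
    have "{i \<in> I. (a + t *\<^sub>R v) \<bullet> p i \<le> 0} \<subseteq> {i \<in> Z v. a \<bullet> p i \<le> 0} \<union> N v"
    proof
      fix i assume i: "i \<in> {i \<in> I. (a + t *\<^sub>R v) \<bullet> p i \<le> 0}"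
      then have "\<not> v \<bullet> p i > 0"
        using t[of i] by auto
      then show "i \<in> {i \<in> Z v. a \<bullet> p i \<le> 0} \<union> N v"
        using i by (auto simp: Z_def N_def inner_add_left)
    qed
    then have "card {i \<in> I. (a + t *\<^sub>R v) \<bullet> p i \<le> 0} \<le> card ({i \<in> Z v. a \<bullet> p i \<le> 0} \<union> N v)"
      using psubset.hyps by (intro card_mono) (auto simp: Z_def N_def)
    also have "\<dots> \<le> card {i \<in> Z v. a \<bullet> p i \<le> 0} + card (N v)"
      by (rule card_Un_le)
    \<comment> \<open>The losses are \<open>3 * card (N v)\<close> from the new labels and 2 from
      the rank; the gain \<open>2 * (card (P v) + card (N v))\<close> covers them.\<close>
    finally have "3 * card {i \<in> I. (a + t *\<^sub>R v) \<bullet> p i \<le> 0} + 2 * dim (p ` I) \<le> 2 * card I + \<nu>"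
      using IH(2) v card_I[of v] by linarith
    moreover have "capturing_family \<nu> I p T"
      using IH(1) \<open>Z v \<subset> I\<close> unfolding capturing_family_def by blast
    ultimately show ?thesis
      by blast
  next
    case False
    \<comment> \<open>Both \<open>v\<close> and \<open>- v\<close> have the same zero set, so the
      failed inequality applies to each; together they leave only one label of each sign.\<close>
    have "card (P v) = 1 \<and> card (N v) = 1"
      if dim: "dim (p ` I) \<le> Suc (dim (p ` Z v))" and ne: "P v \<noteq> {}" for v
    proof -
      have neg: "Z (- v) = Z v" "P (- v) = N v" "N (- v) = P v"
        by (auto simp: Z_def P_def N_def)
      have "2 * card (P v) < card (N v) + 2"
        using False dim by (meson not_le)
      moreover have "2 * card (N v) < card (P v) + 2"
        using False dim neg by (metis not_le)
      moreover have "card (P v) \<noteq> 0"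
        using ne psubset.hyps by (auto simp: P_def)
      ultimately show ?thesis
        by linarith
    qed
    then obtain a T where aT: "capturing_family (card I - dim (p ` I)) I p T"
        "card {i \<in> I. a \<bullet> p i \<le> 0} \<le> card I - dim (p ` I)"
      using capturing_family_if_dual_supports_are_pairs[OF psubset.hyps, of p]
      unfolding Z_def P_def N_def by blast
    \<comment> \<open>This makes the natural subtraction exact; with \<nu> equal to the corank the
      required bound then follows.\<close>
    have "dim (p ` I) \<le> card I"
      using psubset.hyps dim_le_card' card_image_le by (metis finite_imageI order.trans)
    then show ?thesis
      using aT by (intro exI[of _ a] exI[of _ "card I - dim (p ` I)"] exI[of _ T]) auto
  qed
qed

section \<open>Translation to the origin and the core\<close>

lemma zero_in_convex_hull_translate_iff:
  fixes p :: "'i \<Rightarrow> 'a::real_vector"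
  shows "0 \<in> convex hull ((\<lambda>i. p i - x) ` T) \<longleftrightarrow> x \<in> convex hull (p ` T)"
proof -
  have "(\<lambda>i. p i - x) ` T = (+) (- x) ` (p ` T)"
    by (auto simp: image_image)
  then have "convex hull ((\<lambda>i. p i - x) ` T) = (+) (- x) ` (convex hull (p ` T))"
    by (metis convex_hull_translation)
  then show ?thesis
    by (auto simp: image_iff)
qed

lemma dim_translate_of_affine_hull_UNIV:
  fixes p :: "'i \<Rightarrow> 'a::euclidean_space"
  assumes "affine hull (p ` I) = UNIV"
  shows "dim ((\<lambda>i. p i - x) ` I) = DIM('a)"
proof -
  have "(\<lambda>i. p i - x) ` I = (+) (- x) ` (p ` I)"
    by (auto simp: image_image)
  then have "affine hull ((\<lambda>i. p i - x) ` I) = UNIV"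
    using assms by (metis affine_hull_translation surj_plus)
  then have "span ((\<lambda>i. p i - x) ` I) = UNIV"
    using affine_hull_subset_span by blast
  then show ?thesis
    by (metis dim_UNIV dim_span)
qed

lemma core_card_le:
  assumes "finite I" "x \<in> core m I p"
  shows "m \<le> card {i \<in> I. a \<bullet> (p i - x) \<le> 0}"
proof -
  have *: "m \<le> card {i \<in> I. c \<bullet> (p i - x) \<le> 0}" if "c \<noteq> 0" for c
  proof -
    have "closed_halfspace {y. c \<bullet> y \<le> c \<bullet> x}"
      using that unfolding closed_halfspace_def by blast
    then show ?thesis
      using assms(2) unfolding core_def by (fastforce simp: inner_diff_right)
  qed
  show ?thesis
  proof (cases "a = 0")
    case True
    \<comment> \<open>For \<open>a = 0\<close> there is no halfspace, but all of \<open>I\<close> is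
      counted; the all-ones vector provides a genuine halfspace.\<close>
    have "m \<le> card {i \<in> I. 1 \<bullet> (p i - x) \<le> 0}"
      by (rule *) simp
    also have "\<dots> \<le> card I"
      using assms(1) by (intro card_mono) auto
    finally show ?thesis
      using True by simp
  qed (rule *)
qed

theorem mainTheorem3:
  fixes I :: "'i set" and p :: "'i \<Rightarrow> real ^ 'r" and n m :: nat
  assumes "finite I" and "card I = n"
    and "affine hull (p ` I) = UNIV"
    and "m > 0"
  shows "core m I p \<subseteq> tverberg_points (3 * int m - 2 * (int n - int CARD('r))) I p"
proof
  fix x assume x: "x \<in> core m I p"
  let ?q = "\<lambda>i. p i - x" and ?k = "3 * int m - 2 * (int n - int CARD('r))"
  obtain a \<nu> T where T: "capturing_family \<nu> I ?q T"
      and count: "3 * card {i \<in> I. a \<bullet> ?q i \<le> 0} + 2 * dim (?q ` I) \<le> 2 * card I + \<nu>"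
    using capturing_family_and_functional[OF assms(1)] by blast
  have "dim (?q ` I) = CARD('r)"
    using dim_translate_of_affine_hull_UNIV[OF assms(3)] by simp
  then have "3 * m + 2 * CARD('r) \<le> 2 * n + \<nu>"
    using count core_card_le[OF assms(1) x, of a] assms(2) by linarith
  then have k: "?k \<le> int \<nu>"
    by arith
  \<comment> \<open>The integer indices embed into those of \<open>T\<close>; surplus sets are
    dropped, and the range is empty if \<open>?k\<close> is not positive.\<close>
  have nat_in: "nat j \<in> {1..\<nu>}" if "j \<in> {1..?k}" for j
    using that k by auto
  have "disjoint_family_on (T \<circ> nat) {1..?k}"
    unfolding disjoint_family_on_def
  proof (intro ballI impI)
    fix i j assume ij: "i \<in> {1..?k}" "j \<in> {1..?k}" "i \<noteq> j"
    then have "nat i \<noteq> nat j"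
      by auto
    then show "(T \<circ> nat) i \<inter> (T \<circ> nat) j = {}"
      using T nat_in ij unfolding capturing_family_def disjoint_family_on_def by simp
  qed
  moreover have "\<forall>j\<in>{1..?k}. (T \<circ> nat) j \<subseteq> I \<and> x \<in> convex hull (p ` (T \<circ> nat) j)"
    using T nat_in unfolding capturing_family_def zero_in_convex_hull_translate_iff by simp
  ultimately show "x \<in> tverberg_points ?k I p"
    unfolding tverberg_points_def by blast
qed

end
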